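(* Let $D$ be a minimal counterexample to the conjecture stated in the context below. Then every vertex of $D$ is incident with edges of all three colours (red, blue and green).
   Context: A 3-coloured tournament is a finite tournament each of whose edges (arcs) is coloured red, blue or green. A triple of vertices spans a $T_3$ if the three edges between them form a directed cycle and have three distinct colours. For distinct vertices $x,y$, $x$ dominates $y$ monochromatically if there is a directed path from $x$ to $y$ all of whose edges have the same colour; for a subtournament, domination refers to paths inside that subtournament. The conjecture in question states: every finite 3-coloured tournament has either a triple of vertices spanning a $T_3$ or a single vertex that monochromatically dominates every other vertex. A minimal counterexample (with respect to containment) is a 3-coloured tournament $D$ which contains no $T_3$ and no vertex monochromatically dominating all other vertices, but such that every proper nonempty subtournament of $D$ has a $T_3$ or a vertex monochromatically dominating all its other vertices (within that subtournament). *)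

theory Defs
  imports "Graph_Theory.Graph_Theory"
begin

locale tournament = digraph +
  assumes one_direction:
    "\<lbrakk>u \<in> verts G; v \<in> verts G; u \<noteq> v\<rbrakk> \<Longrightarrow> u \<rightarrow> v \<longleftrightarrow> \<not> v \<rightarrow> u"

datatype colour = Red | Blue | Green

text \<open>
  A 3-coloured tournament is a tournament \<open>G\<close> together with a map \<open>c\<close> from arcs to colours; only
  the values of \<open>c\<close> on \<open>arcs G\<close> matter, and a subtournament inherits the same \<open>c\<close>.
\<close>

text \<open>The triple is listed in the order in which the cycle traverses it.\<close>

definition spans_T3 :: "('a, 'b) pre_digraph \<Rightarrow> ('b \<Rightarrow> colour) \<Rightarrow> 'a \<Rightarrow> 'a \<Rightarrow> 'a \<Rightarrow> bool" where
  "spans_T3 G c x y z \<longleftrightarrow> distinct [x, y, z] \<and>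
     (\<exists>e\<in>arcs G. \<exists>f\<in>arcs G. \<exists>g\<in>arcs G.
        arc_to_ends G e = (x, y) \<and> arc_to_ends G f = (y, z) \<and> arc_to_ends G g = (z, x) \<and>
        distinct [c e, c f, c g])"

definition contains_T3 :: "('a, 'b) pre_digraph \<Rightarrow> ('b \<Rightarrow> colour) \<Rightarrow> bool" where
  "contains_T3 G c \<longleftrightarrow>
     (\<exists>x\<in>verts G. \<exists>y\<in>verts G. \<exists>z\<in>verts G. spans_T3 G c x y z)"

definition mono_dominates ::
    "('a, 'b) pre_digraph \<Rightarrow> ('b \<Rightarrow> colour) \<Rightarrow> 'a \<Rightarrow> 'a \<Rightarrow> bool" where
  "mono_dominates G c x y \<longleftrightarrow>
     (\<exists>p k. pre_digraph.apath G x p y \<and> (\<forall>e\<in>set p. c e = k))"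

definition has_mono_dominator :: "('a, 'b) pre_digraph \<Rightarrow> ('b \<Rightarrow> colour) \<Rightarrow> bool" where
  "has_mono_dominator G c \<longleftrightarrow>
     (\<exists>x\<in>verts G. \<forall>y\<in>verts G - {x}. mono_dominates G c x y)"

definition subtournament :: "('a, 'b) pre_digraph \<Rightarrow> ('a, 'b) pre_digraph \<Rightarrow> bool" where
  "subtournament H G \<longleftrightarrow> subgraph H G \<and> tournament H"

text \<open>
  The digraph without vertices satisfies this vacuously. This is harmless for assertions about every
  vertex of a minimal counterexample.
\<close>

definition minimal_counterexample :: "('a, 'b) pre_digraph \<Rightarrow> ('b \<Rightarrow> colour) \<Rightarrow> bool" where
  "minimal_counterexample G c \<longleftrightarrow>
     tournament G \<and> \<not> contains_T3 G c \<and> \<not> has_mono_dominator G c \<and>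
     (\<forall>H. subtournament H G \<and> H \<noteq> G \<and> verts H \<noteq> {} \<longrightarrow>
        contains_T3 H c \<or> has_mono_dominator H c)"

end

theory Submission
  imports Defs
begin

text \<open>
  In a minimal counterexample let \<open>f x\<close> be a vertex dominating everything in \<open>D - x\<close>; it dominates
  every vertex except \<open>x\<close>. Hence \<open>f\<close> is injective and \<open>v\<close> lies on a cycle
  \<open>v = x\<^sub>0, x\<^sub>1, \<dots>, x\<^sub>n = v\<close> with \<open>x\<^sub>i\<^sub>+\<^sub>1 = f x\<^sub>i\<close>. In the subtournament spanned by an interval
  \<open>x\<^sub>i, \<dots>, x\<^sub>j\<close> avoiding \<open>v\<close> the dominating vertex must be \<open>x\<^sub>i\<close>, because \<open>x\<^sub>m\<close> does not dominate
  \<open>x\<^sub>m\<^sub>-\<^sub>1\<close>.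

  Suppose that no arc at \<open>v\<close> has colour \<open>g\<close>, and let \<open>a\<close>, \<open>b\<close> be the other two colours. Starting
  with \<open>i = 1\<close>, suppose that \<open>v \<rightarrow> x\<^sub>i\<close> has colour \<open>a\<close> and that \<open>x\<^sub>i\<close> does not dominate \<open>v\<close> in
  colour \<open>b\<close>. Let \<open>j > i\<close> be least such that \<open>v\<close> does not dominate \<open>x\<^sub>j\<close> in colour \<open>a\<close>. Then
  \<open>x\<^sub>i\<^sub>+\<^sub>1, \<dots>, x\<^sub>j\<close> all dominate \<open>v\<close> in colour \<open>b\<close> only, so that \<open>x\<^sub>i\<close> dominates \<open>x\<^sub>j\<close> within the
  interval in colour \<open>g\<close>. As there is no \<open>T\<^sub>3\<close>, all arcs between \<open>v\<close> and this path leave \<open>v\<close>. So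
  \<open>v \<rightarrow> x\<^sub>j\<close>, in colour \<open>b\<close>, and the argument repeats with \<open>a\<close> and \<open>b\<close> exchanged. It never reaches
  \<open>x\<^sub>n\<^sub>-\<^sub>1\<close>, which \<open>v\<close> does not dominate at all: a contradiction.
\<close>

section \<open>Monochromatic domination as reachability in one relation per colour\<close>

definition colour_rel :: "('a, 'b) pre_digraph \<Rightarrow> ('b \<Rightarrow> colour) \<Rightarrow> colour \<Rightarrow> 'a rel" where
  "colour_rel G c k = {arc_to_ends G e |e. e \<in> arcs G \<and> c e = k}"

lemma colour_rel_induce_subgraph:
  "colour_rel (G \<restriction> S) c k = colour_rel G c k \<inter> S \<times> S"
  by (auto simp: colour_rel_def arc_to_ends_def)

text \<open>The closure yields only a walk; shortening it to a path keeps a subset of its arcs,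
  hence the colour. Membership in \<open>verts G\<close> supplies the empty walk for the reflexive
  case.\<close>

lemma (in wf_digraph) mono_dominates_iff:
  assumes "x \<in> verts G"
  shows "mono_dominates G c x y \<longleftrightarrow> (\<exists>k. (x, y) \<in> (colour_rel G c k)\<^sup>*)"
proof
  assume "mono_dominates G c x y"
  then obtain p k where "awalk x p y" "\<forall>e\<in>set p. c e = k"
    unfolding mono_dominates_def by (auto dest: awalkI_apath)
  then have "(x, y) \<in> (colour_rel G c k)\<^sup>*"
  proof (induction p arbitrary: x)
    case Nil
    then show ?case by (auto simp: awalk_simps)
  next
    case (Cons e p)
    then have "(x, head G e) \<in> colour_rel G c k" "(head G e, y) \<in> (colour_rel G c k)\<^sup>*"
      by (auto simp: awalk_simps colour_rel_def arc_to_ends_def)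
    then show ?case by (rule converse_rtrancl_into_rtrancl)
  qed
  then show "\<exists>k. (x, y) \<in> (colour_rel G c k)\<^sup>*" ..
next
  assume "\<exists>k. (x, y) \<in> (colour_rel G c k)\<^sup>*"
  then obtain k where "(x, y) \<in> (colour_rel G c k)\<^sup>*" ..
  then have "\<exists>p. awalk x p y \<and> (\<forall>e\<in>set p. c e = k)"
  proof (induction rule: rtrancl_induct)
    case base
    show ?case using assms by (intro exI[of _ "[]"]) (simp add: awalk_simps)
  next
    case (step y z)
    then obtain p e where "awalk x p y" "\<forall>e\<in>set p. c e = k"
      and e: "e \<in> arcs G" "c e = k" "arc_to_ends G e = (y, z)"
      by (auto simp: colour_rel_def)
    moreover from e have "awalk y [e] z"
      by (auto simp: awalk_simps arc_to_ends_def)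
    ultimately show ?case
      by (intro exI[of _ "p @ [e]"]) (auto intro: awalk_appendI)
  qed
  then obtain p where p: "awalk x p y" "\<forall>e\<in>set p. c e = k" by blast
  then have "apath x (awalk_to_apath p) y" "\<forall>e\<in>set (awalk_to_apath p). c e = k"
    using apath_awalk_to_apath awalk_to_apath_subset by blast+
  then show "mono_dominates G c x y" unfolding mono_dominates_def by blast
qed

lemma (in tournament) subtournament_induce_subgraph:
  assumes "S \<subseteq> verts G"
  shows "subtournament (G \<restriction> S) G"
proof -
  interpret H: wf_digraph "G \<restriction> S" ..
  have "tournament (G \<restriction> S)"
  proof
    show "finite (verts (G \<restriction> S))" using assms by (auto intro: finite_subset)
    show "finite (arcs (G \<restriction> S))" by simp
    show "tail (G \<restriction> S) e \<noteq> head (G \<restriction> S) e" if "e \<in> arcs (G \<restriction> S)" for e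
      using that no_loops by auto
    show "e1 = e2" if "e1 \<in> arcs (G \<restriction> S)" "e2 \<in> arcs (G \<restriction> S)"
      "arc_to_ends (G \<restriction> S) e1 = arc_to_ends (G \<restriction> S) e2" for e1 e2
      using that no_multi_arcs by auto
    fix u v assume uv: "u \<in> verts (G \<restriction> S)" "v \<in> verts (G \<restriction> S)" "u \<noteq> v"
    have "(x, y) \<in> arcs_ends (G \<restriction> S) \<longleftrightarrow> (x, y) \<in> arcs_ends G" if "x \<in> S" "y \<in> S" for x y
      using that by (auto simp: arcs_ends_conv)
    then show "u \<rightarrow>\<^bsub>G \<restriction> S\<^esub> v \<longleftrightarrow> \<not> v \<rightarrow>\<^bsub>G \<restriction> S\<^esub> u"
      using uv assms one_direction[of u v] by auto
  qed
  then show ?thesis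
    using assms by (simp add: subtournament_def subgraph_induce_subgraphI)
qed

lemma contains_T3_subgraph:
  assumes "subgraph H G" "contains_T3 H c"
  shows "contains_T3 G c"
proof -
  have H: "verts H \<subseteq> verts G" "arcs H \<subseteq> arcs G" "arc_to_ends H = arc_to_ends G"
    using assms(1) by (auto simp: subgraph_def compatible_def arc_to_ends_def fun_eq_iff)
  obtain x y z where xyz: "x \<in> verts H" "y \<in> verts H" "z \<in> verts H" "spans_T3 H c x y z"
    using assms(2) by (auto simp: contains_T3_def)
  have "spans_T3 G c x y z"
    using xyz(4) H(2) unfolding spans_T3_def H(3) by blast
  then show ?thesis
    using xyz(1-3) H(1) unfolding contains_T3_def by blast
qed

lemma (in loopfree_digraph) colour_rel_contains_T3:
  assumes "(x, y) \<in> colour_rel G c i" "(y, z) \<in> colour_rel G c j" "(z, x) \<in> colour_rel G c k"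
    and "distinct [i, j, k]"
  shows "contains_T3 G c"
proof -
  from assms obtain e f g where efg: "e \<in> arcs G" "f \<in> arcs G" "g \<in> arcs G"
    "arc_to_ends G e = (x, y)" "arc_to_ends G f = (y, z)" "arc_to_ends G g = (z, x)"
    "c e = i" "c f = j" "c g = k"
    unfolding colour_rel_def by auto
  then have "x \<in> verts G" "y \<in> verts G" "z \<in> verts G" "distinct [x, y, z]"
    using no_loops[of e] no_loops[of f] no_loops[of g] by (auto simp: arc_to_ends_def)
  moreover have "spans_T3 G c x y z"
    unfolding spans_T3_def using efg assms(4) \<open>distinct [x, y, z]\<close> by blast
  ultimately show ?thesis unfolding contains_T3_def by blast
qed

lemma third_colour:
  fixes a g :: colour
  assumes "a \<noteq> g"
  obtains b where "UNIV = {a, b, g}" "distinct [a, b, g]"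
proof -
  have "UNIV = {Red, Blue, Green}" using colour.exhaust by auto
  then show thesis
    using assms that[of Red] that[of Blue] that[of Green]
    by (cases a; cases g) (simp_all add: insert_commute)
qed

section \<open>The cycle of vertices dominating all but their predecessor\<close>

lemma vertex_deletion_cycle:
  fixes E :: "'c \<Rightarrow> 'a rel"
  assumes fin: "finite V"
    and nodom: "\<And>x. x \<in> V \<Longrightarrow> \<exists>y\<in>V. \<forall>k. (x, y) \<notin> (E k)\<^sup>*"
    and min: "\<And>S. S \<subset> V \<Longrightarrow> S \<noteq> {} \<Longrightarrow> \<exists>x\<in>S. \<forall>y\<in>S. \<exists>k. (x, y) \<in> (E k \<inter> S \<times> S)\<^sup>*"
    and v: "v \<in> V"
  obtains x :: "nat \<Rightarrow> 'a" and n where "n > 0" "x 0 = v" "x n = v"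
    "\<And>m. 0 < m \<Longrightarrow> m < n \<Longrightarrow> x m \<noteq> v" "\<And>m. x m \<in> V"
    "\<And>m k. (x (Suc m), x m) \<notin> (E k)\<^sup>*"
    "\<And>m y. y \<in> V \<Longrightarrow> y \<noteq> x m \<Longrightarrow> \<exists>k. (x (Suc m), y) \<in> (E k)\<^sup>*"
proof -
  have "\<exists>w\<in>V. (\<forall>k. (w, x) \<notin> (E k)\<^sup>*) \<and> (\<forall>y\<in>V - {x}. \<exists>k. (w, y) \<in> (E k)\<^sup>*)"
    if x: "x \<in> V" for x
  proof -
    obtain y where "y \<in> V" "\<forall>k. (x, y) \<notin> (E k)\<^sup>*" using nodom[OF x] by blast
    then have "V - {x} \<noteq> {}" by auto
    moreover have "V - {x} \<subset> V" using x by blast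
    ultimately obtain w where w: "w \<in> V - {x}"
      "\<And>y. y \<in> V - {x} \<Longrightarrow> \<exists>k. (w, y) \<in> (E k \<inter> (V - {x}) \<times> (V - {x}))\<^sup>*"
      using min[of "V - {x}"] by blast
    have *: "\<exists>k. (w, y) \<in> (E k)\<^sup>*" if "y \<in> V - {x}" for y
      using w(2)[OF that] rtrancl_mono by blast
    \<comment> \<open>By \<open>nodom\<close>, \<open>w\<close> misses some vertex of
      \<open>V\<close>, and only \<open>x\<close> is left.\<close>
    moreover have "\<forall>k. (w, x) \<notin> (E k)\<^sup>*" using nodom[of w] w(1) * by blast
    ultimately show ?thesis using w(1) by blast
  qed
  then obtain h where h: "\<And>x. x \<in> V \<Longrightarrow> h x \<in> V"
    "\<And>x k. x \<in> V \<Longrightarrow> (h x, x) \<notin> (E k)\<^sup>*"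
    "\<And>x y. x \<in> V \<Longrightarrow> y \<in> V \<Longrightarrow> y \<noteq> x \<Longrightarrow> \<exists>k. (h x, y) \<in> (E k)\<^sup>*"
    by (metis DiffI singletonD)
  \<comment> \<open>The identity outside \<open>V\<close> makes \<open>f\<close> injective on the
    whole type: \<open>h\<close> maps \<open>V\<close> into \<open>V\<close>, and
    \<open>h x = h y\<close> with \<open>x \<noteq> y\<close> would be a vertex both dominating and
    not dominating \<open>y\<close>.\<close>
  define f where "f x = (if x \<in> V then h x else x)" for x
  have "inj f"
    unfolding inj_def f_def using h by metis
  define x where "x m = (f ^^ m) v" for m
  have xV: "x m \<in> V" for m
    unfolding x_def by (induction m) (auto simp: v f_def h(1))
  have xS: "x (Suc m) = h (x m)" for m
    using xV[of m] by (simp add: x_def f_def)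
  have "finite {y. \<exists>m. y = (f ^^ m) v}"
    using xV by (intro finite_subset[OF _ fin]) (auto simp: x_def)
  then have "\<exists>n>0. x n = v"
    unfolding x_def by (metis funpow_inj_finite[OF \<open>inj f\<close>])
  \<comment> \<open>Taking the first return to \<open>v\<close> ensures that the vertices strictly
    between differ from \<open>v\<close>.\<close>
  then have n: "0 < (LEAST n. 0 < n \<and> x n = v) \<and> x (LEAST n. 0 < n \<and> x n = v) = v"
    using LeastI_ex[of "\<lambda>n. 0 < n \<and> x n = v"] by simp
  show thesis
  proof (rule that)
    show "x m \<noteq> v" if "0 < m" "m < (LEAST n. 0 < n \<and> x n = v)" for m
      using not_less_Least[OF that(2)] that(1) by blast
    show "x 0 = v" by (simp add: x_def)
  qed (use n xV xS h in auto)
qed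

section \<open>Following the cycle from a vertex that misses a colour\<close>

lemma incident_with_all_colours:
  fixes E :: "colour \<Rightarrow> 'a rel"
  assumes fin: "finite V"
    and total: "\<And>x y. x \<in> V \<Longrightarrow> y \<in> V \<Longrightarrow> x \<noteq> y \<Longrightarrow> \<exists>k. (x, y) \<in> E k \<or> (y, x) \<in> E k"
    and noT3: "\<And>x y z i j k. (x, y) \<in> E i \<Longrightarrow> (y, z) \<in> E j \<Longrightarrow> (z, x) \<in> E k \<Longrightarrow>
      \<not> distinct [i, j, k]"
    and nodom: "\<And>x. x \<in> V \<Longrightarrow> \<exists>y\<in>V. \<forall>k. (x, y) \<notin> (E k)\<^sup>*"
    and min: "\<And>S. S \<subset> V \<Longrightarrow> S \<noteq> {} \<Longrightarrow> \<exists>x\<in>S. \<forall>y\<in>S. \<exists>k. (x, y) \<in> (E k \<inter> S \<times> S)\<^sup>*"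
    and v: "v \<in> V"
  shows "\<exists>u. (u, v) \<in> E g \<or> (v, u) \<in> E g"
proof (rule ccontr)
  assume "\<not> ?thesis"
  then have no_g: "\<And>u. (u, v) \<notin> E g" "\<And>u. (v, u) \<notin> E g" by auto
  obtain x n where "n > 0" and x: "x 0 = v" "x n = v"
    "\<And>m. 0 < m \<Longrightarrow> m < n \<Longrightarrow> x m \<noteq> v" "\<And>m. x m \<in> V"
    "\<And>m k. (x (Suc m), x m) \<notin> (E k)\<^sup>*"
    "\<And>m y. y \<in> V \<Longrightarrow> y \<noteq> x m \<Longrightarrow> \<exists>k. (x (Suc m), y) \<in> (E k)\<^sup>*"
    by (rule vertex_deletion_cycle[OF fin nodom min v]) blast+
  have x_neq: "x (Suc m) \<noteq> x m" for m
    using x(5)[of m] by auto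
  have "n > 1"
    using \<open>n > 0\<close> x(1,2) x_neq[of 0] by (cases "n = 1") auto
  have last: "(v, x (n - 1)) \<notin> (E k)\<^sup>*" for k
    using x(5)[of "n - 1" k] x(2) \<open>n > 0\<close> by simp
  \<comment> \<open>The last arc of a nontrivial path into \<open>v\<close> would have colour
    \<open>g\<close>.\<close>
  have no_g_path: "(y, v) \<notin> (E g)\<^sup>*" if "y \<noteq> v" for y
    using that no_g(1) by (metis rtranclE)
  have interval: "\<exists>k. (x i, x j) \<in> (E k \<inter> x ` {i..j} \<times> x ` {i..j})\<^sup>*"
    if ij: "0 < i" "i \<le> j" "j < n" for i j
  proof -
    let ?S = "x ` {i..j}"
    have "x m \<noteq> v" if "m \<in> {i..j}" for m using x(3)[of m] that ij by simp
    then have "v \<notin> ?S" by blast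
    moreover have "?S \<subseteq> V" using x(4) by blast
    ultimately have "?S \<subset> V" using v by blast
    moreover have "?S \<noteq> {}" using ij by simp
    ultimately obtain w where w: "w \<in> ?S" "\<forall>y\<in>?S. \<exists>k. (w, y) \<in> (E k \<inter> ?S \<times> ?S)\<^sup>*"
      using min[of ?S] by meson
    from w(1) obtain m where m: "m \<in> {i..j}" "w = x m" by (elim imageE)
    have "m = i"
    proof (rule ccontr)
      assume "m \<noteq> i"
      then obtain m' where m': "m = Suc m'" "m' \<in> {i..j}" using m(1) by (cases m) auto
      then obtain k where "(x m, x m') \<in> (E k \<inter> ?S \<times> ?S)\<^sup>*" using w m by blast
      then have "(x m, x m') \<in> (E k)\<^sup>*" using rtrancl_mono[of "E k \<inter> ?S \<times> ?S" "E k"] by blast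
      then show False using x(5) m' by blast
    qed
    then show ?thesis using w m ij by auto
  qed
  have descent: False if "0 < i" "i < n" "UNIV = {a, b, g}" "distinct [a, b, g]"
    "(v, x i) \<in> E a" "(x i, v) \<notin> (E b)\<^sup>*" for i a b
    using that
  proof (induction "n - i" arbitrary: i a b rule: less_induct)
    case less
    note i = \<open>0 < i\<close> \<open>i < n\<close> and cols = \<open>UNIV = {a, b, g}\<close> \<open>distinct [a, b, g]\<close>
      and vxi = \<open>(v, x i) \<in> E a\<close> and xiv = \<open>(x i, v) \<notin> (E b)\<^sup>*\<close>
    have col: "k = a \<or> k = b \<or> k = g" for k
      using UNIV_I[of k] unfolding cols(1) by simp
    have "i \<noteq> n - 1" using vxi last by blast
    define j where "j = (LEAST j. i < j \<and> (v, x j) \<notin> (E a)\<^sup>*)"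
    \<comment> \<open>The index \<open>n - 1\<close> shows that the least \<open>j\<close> exists
      and stays below \<open>n\<close>.\<close>
    have ex: "i < n - 1 \<and> (v, x (n - 1)) \<notin> (E a)\<^sup>*" using \<open>i \<noteq> n - 1\<close> i last by auto
    then have j: "i < j" "(v, x j) \<notin> (E a)\<^sup>*"
      using LeastI[of "\<lambda>j. i < j \<and> (v, x j) \<notin> (E a)\<^sup>*" "n - 1"] by (auto simp: j_def)
    have "j \<le> n - 1"
      using Least_le[of "\<lambda>j. i < j \<and> (v, x j) \<notin> (E a)\<^sup>*" "n - 1"] ex by (simp add: j_def)
    then have "j < n" using i by simp
    have before: "(v, x m) \<in> (E a)\<^sup>*" if "i \<le> m" "m < j" for m
      using that vxi not_less_Least[of m "\<lambda>j. i < j \<and> (v, x j) \<notin> (E a)\<^sup>*"]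
      by (cases "m = i") (auto simp: j_def)
    \<comment> \<open>Reaching \<open>v\<close> in colour \<open>a\<close> would let
      \<open>x m\<close> go on to its predecessor \<open>x m'\<close>, which it cannot dominate. It
      does dominate \<open>v \<noteq> x m'\<close>, and \<open>g\<close> is impossible, so
      \<open>b\<close> remains.\<close>
    have x_v: "(x m, v) \<notin> (E a)\<^sup>* \<and> (x m, v) \<in> (E b)\<^sup>*" if m: "i < m" "m \<le> j" for m
    proof -
      obtain m' where m': "m = Suc m'" "i \<le> m'" "m' < j" using m by (cases m) auto
      have notc: "(x m, v) \<notin> (E a)\<^sup>*"
        using before[OF m'(2,3)] x(5)[of m' a] m'(1) by (metis rtrancl_trans)
      have "x m' \<noteq> v" using x(3)[of m'] m' i \<open>j < n\<close> by simp
      then obtain k where k: "(x m, v) \<in> (E k)\<^sup>*" using x(6)[of v m'] v m' by auto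
      have "x m \<noteq> v" using x(3)[of m] m i \<open>j < n\<close> by simp
      then have "k \<noteq> g" using k no_g_path by blast
      then have "k = b" using k notc col[of k] by auto
      then show ?thesis using k notc by blast
    qed
    \<comment> \<open>Otherwise \<open>x (Suc m)\<close> would reach \<open>x m\<close> through
      \<open>v\<close> in colour \<open>b\<close>.\<close>
    have not_b: "(v, x m) \<notin> E b" if "i \<le> m" "m < j" for m
    proof
      assume "(v, x m) \<in> E b"
      moreover have "(x (Suc m), v) \<in> (E b)\<^sup>*" using x_v that by simp
      ultimately show False using x(5)[of m b] by (meson rtrancl_into_rtrancl)
    qed
    let ?S = "x ` {i..j}"
    obtain k where k: "(x i, x j) \<in> (E k \<inter> ?S \<times> ?S)\<^sup>*"
      using interval[of i j] i j(1) \<open>j < n\<close> by auto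
    then have k': "(x i, x j) \<in> (E k)\<^sup>*" using rtrancl_mono[of "E k \<inter> ?S \<times> ?S" "E k"] by blast
    \<comment> \<open>Colour \<open>a\<close> would take \<open>v\<close> to \<open>x j\<close>
      through \<open>x i\<close>; colour \<open>b\<close> would take \<open>x i\<close> to
      \<open>v\<close> through \<open>x j\<close>.\<close>
    have "k \<noteq> a" using k' vxi j(2) by (meson converse_rtrancl_into_rtrancl)
    moreover have "k \<noteq> b" using k' xiv x_v[of j] j(1) by (meson order_refl rtrancl_trans)
    ultimately have "k = g" using col[of k] by simp
    \<comment> \<open>If not, every arc from \<open>v\<close> into the interval has colour
      \<open>a\<close>, and this propagates along the \<open>g\<close>-path: for
      \<open>(p, q)\<close> in \<open>E g\<close>, an arc from \<open>q\<close> back to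
      \<open>v\<close> would have colour \<open>b\<close>, making \<open>v, p, q\<close> a forbidden
      triangle. At \<open>x j\<close> this contradicts the choice of \<open>j\<close>.\<close>
    have "(v, x j) \<in> E b"
    proof (rule ccontr)
      assume "\<not> ?thesis"
      then have out_a: "(v, y) \<in> E a" if "y \<in> ?S" "(v, y) \<in> E l" for y l
        using that not_b no_g(2) \<open>(v, x j) \<notin> E b\<close> col[of l] by (auto simp: le_less)
      from k have "(v, x j) \<in> E a"
      proof (induction rule: rtrancl_induct)
        case base
        show ?case by fact
      next
        case (step p q)
        then have pq: "(p, q) \<in> E g" "q \<in> ?S" using \<open>k = g\<close> by auto
        then obtain m where m: "q = x m" "i \<le> m" "m \<le> j" by auto
        have "q \<noteq> v" using m x(3)[of m] i \<open>j < n\<close> by auto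
        then obtain l where l: "(v, q) \<in> E l \<or> (q, v) \<in> E l"
          using total[of v q] v m x(4) by blast
        show ?case
        proof (cases "m = i")
          case True
          then show ?thesis using vxi m by simp
        next
          case False
          have "(q, v) \<notin> E l"
          proof
            assume qv: "(q, v) \<in> E l"
            have "l \<noteq> a" using qv x_v[of m] m False by (metis le_neq_implies_less r_into_rtrancl)
            moreover have "l \<noteq> g" using qv no_g by blast
            ultimately have "l = b" using col[of l] by simp
            then show False using noT3[OF step.IH pq(1) qv] cols(2) by auto
          qed
          then show ?thesis using l out_a[OF pq(2)] by blast
        qed
      qed
      then show False using j(2) by blast
    qed
    moreover have "(x j, v) \<notin> (E a)\<^sup>*" using x_v j(1) by blast
    moreover have "n - j < n - i" using j(1) \<open>j < n\<close> by linarith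
    moreover have "UNIV = {b, a, g}" "distinct [b, a, g]" using cols by auto
    ultimately show False
      using less.hyps[of j b a] i j(1) \<open>j < n\<close> by simp
  qed
  have "x 1 \<noteq> v" using x(3)[of 1] \<open>n > 1\<close> by simp
  \<comment> \<open>Failure in every colour both orients the arc away from \<open>v\<close> and
    starts the descent, whichever colour is \<open>b\<close>.\<close>
  moreover have x1v: "(x 1, v) \<notin> (E k)\<^sup>*" for k using x(5)[of 0] x(1) by simp
  ultimately obtain a where a: "(v, x 1) \<in> E a"
    using total[of v "x 1"] v x(4) by blast
  then have "a \<noteq> g" using no_g by blast
  then obtain b where "UNIV = {a, b, g}" "distinct [a, b, g]"
    by (rule third_colour)
  then show False using descent[of 1 a b] a x1v \<open>n > 1\<close> by simp
qed

section \<open>Transfer to tournaments\<close>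

theorem theorem3p1:
  fixes D :: "('a, 'b) pre_digraph" and c :: "'b \<Rightarrow> colour"
  assumes "minimal_counterexample D c"
  shows "\<forall>v\<in>verts D. \<forall>k. \<exists>e\<in>in_arcs D v \<union> out_arcs D v. c e = k"
proof (intro ballI allI)
  fix v g assume v: "v \<in> verts D"
  from assms have noT3: "\<not> contains_T3 D c" and nodom: "\<not> has_mono_dominator D c"
    and min: "\<And>H. subtournament H D \<Longrightarrow> H \<noteq> D \<Longrightarrow> verts H \<noteq> {} \<Longrightarrow>
      contains_T3 H c \<or> has_mono_dominator H c"
    by (auto simp: minimal_counterexample_def)
  interpret tournament D using assms by (simp add: minimal_counterexample_def)
  have "\<exists>u. (u, v) \<in> colour_rel D c g \<or> (v, u) \<in> colour_rel D c g"
  proof (rule incident_with_all_colours[where V = "verts D"])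
    show "\<exists>k. (x, y) \<in> colour_rel D c k \<or> (y, x) \<in> colour_rel D c k"
      if "x \<in> verts D" "y \<in> verts D" "x \<noteq> y" for x y
    proof -
      from one_direction[OF that] obtain e
        where "e \<in> arcs D" "arc_to_ends D e = (x, y) \<or> arc_to_ends D e = (y, x)"
        unfolding arcs_ends_def by (metis imageE)
      then show ?thesis by (force simp: colour_rel_def)
    qed
    show "\<not> distinct [i, j, k]" if "(x, y) \<in> colour_rel D c i" "(y, z) \<in> colour_rel D c j"
      "(z, x) \<in> colour_rel D c k" for x y z i j k
      using colour_rel_contains_T3[OF that] noT3 by blast
    show "\<exists>y\<in>verts D. \<forall>k. (x, y) \<notin> (colour_rel D c k)\<^sup>*" if "x \<in> verts D" for x
      using nodom that mono_dominates_iff unfolding has_mono_dominator_def by blast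
    fix S assume S: "S \<subset> verts D" "S \<noteq> {}"
    let ?H = "D \<restriction> S"
    interpret H: wf_digraph ?H ..
    have sub: "subtournament ?H D" using S subtournament_induce_subgraph by blast
    then have "\<not> contains_T3 ?H c"
      using noT3 contains_T3_subgraph unfolding subtournament_def by blast
    moreover have "?H \<noteq> D" using S by (metis induce_subgraph_verts psubset_eq)
    ultimately have "has_mono_dominator ?H c" using min[OF sub] S by auto
    then obtain x where x: "x \<in> S" "\<forall>y\<in>S - {x}. mono_dominates ?H c x y"
      unfolding has_mono_dominator_def by auto
    then have "\<exists>k. (x, y) \<in> (colour_rel ?H c k)\<^sup>*" if "y \<in> S" for y
      using that H.mono_dominates_iff[of x c y] by (cases "y = x") auto
    then show "\<exists>x\<in>S. \<forall>y\<in>S. \<exists>k. (x, y) \<in> (colour_rel D c k \<inter> S \<times> S)\<^sup>*"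
      using x(1) unfolding colour_rel_induce_subgraph by blast
  qed (use v in auto)
  then obtain e where "e \<in> arcs D" "c e = g" "head D e = v \<or> tail D e = v"
    by (auto simp: colour_rel_def arc_to_ends_def)
  then show "\<exists>e\<in>in_arcs D v \<union> out_arcs D v. c e = g" by auto
qed

end
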